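(* Let $\boldsymbol{X}=(X_1,\dots,X_d)$ follow the multivariate common shock Poisson distribution with parameters $(\theta_0,\theta_1,\dots,\theta_d)\in(0,\infty)^{d+1}$, with $X_j=Y_0+Y_j$, and let $i\in\{1,\dots,d\}$. Then for every $x\in\mathbb N=\{0,1,2,\dots\}$, as $\theta_i\to\infty$ with all other parameters fixed, $$F_{M^{\boldsymbol X}}(x)\sim F_{X_i}(x)\,F_{M_{-i}^{\boldsymbol Y}}(x),\qquad F_{m^{\boldsymbol X}}(x)\sim F_{m_{-i}^{\boldsymbol X}}(x).$$
   Context: A random vector $(X_1,\dots,X_d)$ has the multivariate common shock Poisson distribution with parameters $(\theta_0,\theta_1,\dots,\theta_d)\in(0,\infty)^{d+1}$ if $X_j=Y_0+Y_j$ for $j=1,\dots,d$, where $Y_0,Y_1,\dots,Y_d$ are mutually independent and $Y_j$ is Poisson distributed with rate $\theta_j$, $j=0,1,\dots,d$. Write $\boldsymbol Y=(Y_1,\dots,Y_d)$. For a random vector $\boldsymbol\xi=(\xi_1,\dots,\xi_d)$: $M^{\boldsymbol\xi}=\max(\xi_1,\dots,\xi_d)$, $m^{\boldsymbol\xi}=\min(\xi_1,\dots,\xi_d)$, and $M_{-i}^{\boldsymbol\xi}$, $m_{-i}^{\boldsymbol\xi}$ are the maximum and minimum of the components $\xi_j$ with $j\ne i$. $F_W$ denotes the cumulative distribution function of a random variable $W$. The notation $f(x;\kappa)\sim g(x;\kappa)$ as $\kappa\to\kappa_0$ means $\lim_{\kappa\to\kappa_0}f(x;\kappa)/g(x;\kappa)=1$.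 *)

theory Defs
  imports "HOL-Probability.Probability"
begin

text \<open>
  The vector \<open>X = (X 1, \<dots>, X d)\<close> on the probability space \<open>M\<close> has the multivariate common shock
  Poisson distribution with parameters \<open>(\<theta> 0, \<dots>, \<theta> d)\<close>, represented through the independent
  Poisson variables \<open>Y 0, \<dots>, Y d\<close>. The values of \<open>\<theta>\<close>, \<open>X\<close>, \<open>Y\<close> at other indices are irrelevant.
\<close>
definition common_shock_poisson ::
  "'a measure \<Rightarrow> nat \<Rightarrow> (nat \<Rightarrow> real) \<Rightarrow> (nat \<Rightarrow> 'a \<Rightarrow> nat) \<Rightarrow> (nat \<Rightarrow> 'a \<Rightarrow> nat) \<Rightarrow> bool" where
  "common_shock_poisson M d \<theta> X Y \<longleftrightarrow>
     prob_space M \<and>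
     (\<forall>j\<in>{0..d}. 0 < \<theta> j) \<and>
     prob_space.indep_vars M (\<lambda>_. count_space UNIV) Y {0..d} \<and>
     (\<forall>j\<in>{0..d}. distr M (count_space UNIV) (Y j) = measure_pmf (poisson_pmf (\<theta> j))) \<and>
     (\<forall>j\<in>{1..d}. \<forall>\<omega>\<in>space M. X j \<omega> = Y 0 \<omega> + Y j \<omega>)"

definition max_over :: "nat set \<Rightarrow> (nat \<Rightarrow> 'a \<Rightarrow> nat) \<Rightarrow> 'a \<Rightarrow> nat" where
  "max_over J \<xi> \<omega> = Max ((\<lambda>j. \<xi> j \<omega>) ` J)"

definition min_over :: "nat set \<Rightarrow> (nat \<Rightarrow> 'a \<Rightarrow> nat) \<Rightarrow> 'a \<Rightarrow> nat" where
  "min_over J \<xi> \<omega> = Min ((\<lambda>j. \<xi> j \<omega>) ` J)"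

definition cdf_of :: "'a measure \<Rightarrow> ('a \<Rightarrow> nat) \<Rightarrow> real \<Rightarrow> real" where
  "cdf_of M W = cdf (distr M borel (\<lambda>\<omega>. real (W \<omega>)))"

end

theory Submission
  imports Defs
begin

text \<open>
  Each limit follows from a comparison of events. For the maximum, the event
  \<open>{M\<^sup>X \<le> x}\<close> is contained in \<open>{X\<^sub>i \<le> x} \<inter> {M\<^sub>-\<^sub>i\<^sup>Y \<le> x}\<close>, an intersection of independent
  events, and the difference forces \<open>Y\<^sub>0 \<ge> 1\<close>, hence \<open>Y\<^sub>i < x\<close>. Since \<open>P(X\<^sub>i \<le> x) \<ge> P(Y\<^sub>0 = 0) P(Y\<^sub>i = x)\<close>,
  the relative error is at most a constant times \<open>P(Y\<^sub>i < x) / P(Y\<^sub>i = x)\<close>, which vanishes as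
  the rate of \<open>Y\<^sub>i\<close> grows. For the minimum, the two events differ inside \<open>{Y\<^sub>i \<le> x}\<close>, whose
  probability vanishes, while \<open>P(m\<^sub>-\<^sub>i\<^sup>X \<le> x) \<ge> P(Y\<^sub>0 = 0) P(Y\<^sub>j = 0)\<close> for any \<open>j \<noteq> i\<close>.
\<close>

section \<open>Relative errors, and distribution functions of extrema as probabilities of
  events\<close>

lemma abs_div_minus_one_le:
  fixes a b e :: real
  assumes "0 < b" "\<bar>a - b\<bar> \<le> e"
  shows "\<bar>a / b - 1\<bar> \<le> e / b"
proof -
  have "a / b - 1 = (a - b) / b"
    using assms(1) by (simp add: diff_divide_distrib)
  then show ?thesis
    using assms by (simp add: abs_divide divide_right_mono)
qed

lemma measurable_add_nat:
  fixes f g :: "'a \<Rightarrow> nat"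
  assumes [measurable]: "f \<in> measurable M (count_space UNIV)" "g \<in> measurable M (count_space UNIV)"
  shows "(\<lambda>\<omega>. f \<omega> + g \<omega>) \<in> measurable M (count_space UNIV)"
  by measurable

lemma cdf_of_nat:
  assumes "W \<in> measurable M (count_space UNIV)"
  shows "cdf_of M W (real x) = measure M {\<omega> \<in> space M. W \<omega> \<le> x}"
proof -
  have [measurable]: "(\<lambda>\<omega>. real (W \<omega>)) \<in> borel_measurable M"
    using assms by measurable
  have "cdf_of M W (real x) = measure M ((\<lambda>\<omega>. real (W \<omega>)) -` {..real x} \<inter> space M)"
    by (simp add: cdf_of_def cdf_def measure_distr)
  also have "(\<lambda>\<omega>. real (W \<omega>)) -` {..real x} \<inter> space M = {\<omega> \<in> space M. W \<omega> \<le> x}"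
    by auto
  finally show ?thesis .
qed

lemma measurable_max_over:
  assumes "finite J" "J \<noteq> {}" "\<And>j. j \<in> J \<Longrightarrow> \<xi> j \<in> measurable M (count_space UNIV)"
  shows "max_over J \<xi> \<in> measurable M (count_space UNIV)"
proof -
  have "(\<lambda>\<omega>. Max ((\<lambda>j. \<xi> j \<omega>) ` J)) \<in> measurable M (count_space UNIV)"
    using assms
  proof (induction J rule: finite_ne_induct)
    case (insert j J)
    have [measurable]: "\<xi> j \<in> measurable M (count_space UNIV)"
      "(\<lambda>\<omega>. Max ((\<lambda>j. \<xi> j \<omega>) ` J)) \<in> measurable M (count_space UNIV)"
      using insert by auto
    show ?case using insert by simp
  qed simp
  then show ?thesis by (simp add: max_over_def[abs_def])
qed

lemma measurable_min_over:
  assumes "finite J" "J \<noteq> {}" "\<And>j. j \<in> J \<Longrightarrow> \<xi> j \<in> measurable M (count_space UNIV)"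
  shows "min_over J \<xi> \<in> measurable M (count_space UNIV)"
proof -
  have "(\<lambda>\<omega>. Min ((\<lambda>j. \<xi> j \<omega>) ` J)) \<in> measurable M (count_space UNIV)"
    using assms
  proof (induction J rule: finite_ne_induct)
    case (insert j J)
    have [measurable]: "\<xi> j \<in> measurable M (count_space UNIV)"
      "(\<lambda>\<omega>. Min ((\<lambda>j. \<xi> j \<omega>) ` J)) \<in> measurable M (count_space UNIV)"
      using insert by auto
    show ?case using insert by simp
  qed simp
  then show ?thesis by (simp add: min_over_def[abs_def])
qed

lemma cdf_of_max_over:
  assumes "finite J" "J \<noteq> {}" "\<And>j. j \<in> J \<Longrightarrow> \<xi> j \<in> measurable M (count_space UNIV)"
  shows "cdf_of M (max_over J \<xi>) (real x) = measure M {\<omega> \<in> space M. \<forall>j\<in>J. \<xi> j \<omega> \<le> x}"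
  using assms(1,2)
  by (subst cdf_of_nat[OF measurable_max_over[OF assms]]) (auto simp: max_over_def intro!: arg_cong[where f = "measure M"])

lemma cdf_of_min_over:
  assumes "finite J" "J \<noteq> {}" "\<And>j. j \<in> J \<Longrightarrow> \<xi> j \<in> measurable M (count_space UNIV)"
  shows "cdf_of M (min_over J \<xi>) (real x) = measure M {\<omega> \<in> space M. \<exists>j\<in>J. \<xi> j \<omega> \<le> x}"
  using assms(1,2)
  by (subst cdf_of_nat[OF measurable_min_over[OF assms]]) (auto simp: min_over_def Min_le_iff intro!: arg_cong[where f = "measure M"])

section \<open>Independence and marginals in the model at one fixed parameter vector\<close>

context
  fixes M :: "'a measure" and d :: nat and \<theta> :: "nat \<Rightarrow> real" and X Y :: "nat \<Rightarrow> 'a \<Rightarrow> nat"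
  assumes csp: "common_shock_poisson M d \<theta> X Y"
begin

interpretation prob_space M
  using csp by (simp add: common_shock_poisson_def)

lemma common_shock_indep: "indep_vars (\<lambda>_. count_space UNIV) Y {0..d}"
  using csp by (simp add: common_shock_poisson_def)

lemma common_shock_measurable_Y: "j \<le> d \<Longrightarrow> Y j \<in> measurable M (count_space UNIV)"
  using common_shock_indep by (auto simp: indep_vars_def)

lemma common_shock_X: "j \<in> {1..d} \<Longrightarrow> \<omega> \<in> space M \<Longrightarrow> X j \<omega> = Y 0 \<omega> + Y j \<omega>"
  using csp by (simp add: common_shock_poisson_def)

lemma common_shock_measurable_X:
  assumes "j \<in> {1..d}"
  shows "X j \<in> measurable M (count_space UNIV)"
proof -
  have "(\<lambda>\<omega>. Y 0 \<omega> + Y j \<omega>) \<in> measurable M (count_space UNIV)"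
    using assms by (intro measurable_add_nat common_shock_measurable_Y) auto
  then show ?thesis
    \<comment> \<open>\<open>X j\<close> is prescribed only on \<open>space M\<close>, so
      measurability is carried over from the sum by congruence on that space.\<close>
    using assms common_shock_X by (subst measurable_cong[where g = "\<lambda>\<omega>. Y 0 \<omega> + Y j \<omega>"]) auto
qed

lemma common_shock_event_X: "j \<in> {1..d} \<Longrightarrow> {\<omega> \<in> space M. X j \<omega> \<le> x} \<in> events"
  using measurable_sets[OF common_shock_measurable_X, of j "{..x}"]
  by (simp add: vimage_def Int_def conj_commute)

lemma common_shock_event_Y: "j \<le> d \<Longrightarrow> {\<omega> \<in> space M. P (Y j \<omega>)} \<in> events"
  using measurable_sets[OF common_shock_measurable_Y, of j "Collect P"]
  by (simp add: vimage_def Int_def conj_commute)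

lemma common_shock_marginal:
  assumes "j \<le> d"
  shows "prob {\<omega> \<in> space M. Y j \<omega> \<in> A} = measure_pmf.prob (poisson_pmf (\<theta> j)) A"
proof -
  have "measure (distr M (count_space UNIV) (Y j)) A = prob {\<omega> \<in> space M. Y j \<omega> \<in> A}"
    using common_shock_measurable_Y[OF assms]
    by (subst measure_distr) (auto intro!: arg_cong[where f = prob])
  moreover have "distr M (count_space UNIV) (Y j) = measure_pmf (poisson_pmf (\<theta> j))"
    using csp assms by (simp add: common_shock_poisson_def)
  ultimately show ?thesis by simp
qed

lemma common_shock_joint:
  assumes "K \<subseteq> {0..d}" "K \<noteq> {}"
  shows "prob {\<omega> \<in> space M. \<forall>j\<in>K. Y j \<omega> \<in> A j} = (\<Prod>j\<in>K. measure_pmf.prob (poisson_pmf (\<theta> j)) (A j))"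
proof -
  have "finite K" using assms finite_subset by blast
  have "prob (\<Inter>j\<in>K. Y j -` A j \<inter> space M) = (\<Prod>j\<in>K. prob (Y j -` A j \<inter> space M))"
    using assms \<open>finite K\<close> by (intro indep_varsD[OF common_shock_indep]) auto
  moreover have "(\<Inter>j\<in>K. Y j -` A j \<inter> space M) = {\<omega> \<in> space M. \<forall>j\<in>K. Y j \<omega> \<in> A j}"
    using assms by auto
  moreover have "prob (Y j -` A j \<inter> space M) = measure_pmf.prob (poisson_pmf (\<theta> j)) (A j)"
    if "j \<in> K" for j
    using assms that by (subst common_shock_marginal[symmetric])
      (auto intro!: arg_cong[where f = prob])
  ultimately show ?thesis by simp
qed

text \<open>Source of the lower bounds on the denominators: the no-shock case \<open>k = 0\<close>
  is combined with \<open>l = x\<close> for the maximum and with \<open>l = 0\<close> for the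
  minimum.\<close>

lemma common_shock_point:
  assumes "j \<in> {1..d}"
  shows "prob {\<omega> \<in> space M. Y 0 \<omega> = k \<and> Y j \<omega> = l}
           = pmf (poisson_pmf (\<theta> 0)) k * pmf (poisson_pmf (\<theta> j)) l"
  \<comment> \<open>Since \<open>j\<close> is at least 1, the indices 0 and \<open>j\<close> differ,
    so the test on \<open>n\<close> separates them and the product has exactly two factors.\<close>
  using common_shock_joint[of "{0, j}" "\<lambda>n. if n = 0 then {k} else {l}"] assms
  by (simp add: measure_pmf_single)

text \<open>\<open>X i\<close> is a function of \<open>Y 0\<close> and \<open>Y i\<close>, while the
  other condition involves only indices in \<open>J\<close>, which contains neither 0 nor
  \<open>i\<close>. Functions of disjoint blocks of an independent family are independent.\<close>

lemma common_shock_split: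
  assumes "i \<in> {1..d}" "J = {1..d} - {i}"
  shows "prob {\<omega> \<in> space M. X i \<omega> \<le> x \<and> (\<forall>j\<in>J. Y j \<omega> \<le> x)}
           = prob {\<omega> \<in> space M. X i \<omega> \<le> x} * prob {\<omega> \<in> space M. \<forall>j\<in>J. Y j \<omega> \<le> x}"
proof -
  let ?N = "\<lambda>_::nat. count_space (UNIV :: nat set)"
  let ?f = "\<lambda>K \<omega>. restrict (\<lambda>j. Y j \<omega>) K"
  \<comment> \<open>The two events are recoded as sets \<open>B\<close> and \<open>C\<close> in the
    product spaces of the blocks, so that independence of the restricted families applies to
    them.\<close>
  define B where "B = {y \<in> space (PiM {0, i} ?N). y 0 + y i \<le> x}"
  define C where "C = {y \<in> space (PiM J ?N). \<forall>j\<in>J. y j \<le> x}"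
  have "finite J" using assms by simp
  have "indep_var (PiM {0, i} ?N) (?f {0, i}) (PiM J ?N) (?f J)"
    using assms by (intro indep_var_restrict[OF common_shock_indep]) auto
  moreover have "B \<in> sets (PiM {0, i} ?N)"
  proof -
    have "(\<lambda>y. y 0 + y i) \<in> measurable (PiM {0, i} ?N) (count_space UNIV)"
      by (intro measurable_add_nat measurable_component_singleton) auto
    from measurable_sets[OF this, of "{..x}"] show ?thesis
      by (simp add: B_def vimage_def Int_def conj_commute)
  qed
  moreover have "C \<in> sets (PiM J ?N)"
    unfolding C_def
  proof (rule sets.sets_Collect_finite_All)
    fix j assume "j \<in> J"
    then have "(\<lambda>y. y j) \<in> measurable (PiM J ?N) (count_space UNIV)"
      by (rule measurable_component_singleton)
    from measurable_sets[OF this, of "{..x}"]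
    show "{y \<in> space (PiM J ?N). y j \<le> x} \<in> sets (PiM J ?N)"
      by (simp add: vimage_def Int_def conj_commute)
  qed fact
  ultimately have "prob ((\<lambda>\<omega>. (?f {0, i} \<omega>, ?f J \<omega>)) -` (B \<times> C) \<inter> space M)
      = prob (?f {0, i} -` B \<inter> space M) * prob (?f J -` C \<inter> space M)"
    by (rule indep_varD)
  moreover have "?f {0, i} -` B \<inter> space M = {\<omega> \<in> space M. X i \<omega> \<le> x}"
    using assms common_shock_X by (auto simp: B_def space_PiM)
  moreover have "?f J -` C \<inter> space M = {\<omega> \<in> space M. \<forall>j\<in>J. Y j \<omega> \<le> x}"
    by (auto simp: C_def space_PiM)
  moreover have "(\<lambda>\<omega>. (?f {0, i} \<omega>, ?f J \<omega>)) -` (B \<times> C) \<inter> space M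
      = {\<omega> \<in> space M. X i \<omega> \<le> x \<and> (\<forall>j\<in>J. Y j \<omega> \<le> x)}"
    using assms common_shock_X by (auto simp: B_def C_def space_PiM)
  ultimately show ?thesis by simp
qed

section \<open>Relative error bounds at fixed rates\<close>

text \<open>The bound is arranged so that the rate of index \<open>i\<close> enters only through the
  first quotient; the remaining divisor involves only index 0 and the indices in \<open>J\<close>,
  and stays constant in the limit.\<close>

lemma common_shock_max_error:
  assumes d: "d \<ge> 2" and i: "i \<in> {1..d}" and J: "J = {1..d} - {i}"
  shows "\<bar>cdf_of M (max_over {1..d} X) (real x) /
            (cdf_of M (X i) (real x) * cdf_of M (max_over J Y) (real x)) - 1\<bar>
         \<le> measure_pmf.prob (poisson_pmf (\<theta> i)) {..<x} / pmf (poisson_pmf (\<theta> i)) x /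
            (pmf (poisson_pmf (\<theta> 0)) 0 * (\<Prod>j\<in>J. measure_pmf.prob (poisson_pmf (\<theta> j)) {..x}))"
proof -
  have Jne: "J \<noteq> {}" and finJ: "finite J" and Jd: "J \<subseteq> {0..d}"
  proof -
    have "(if i = 1 then 2 else 1) \<in> J" using d i J by auto
    then show "J \<noteq> {}" by blast
  qed (use J in auto)
  have pos: "\<theta> j > 0" if "j \<le> d" for j
    using csp that by (simp add: common_shock_poisson_def)
  define A where "A = {\<omega> \<in> space M. \<forall>j\<in>{1..d}. X j \<omega> \<le> x}"
  define B where "B = {\<omega> \<in> space M. X i \<omega> \<le> x}"
  define C where "C = {\<omega> \<in> space M. \<forall>j\<in>J. Y j \<omega> \<le> x}"
  define D where "D = {\<omega> \<in> space M. X i \<omega> \<le> x \<and> (\<forall>j\<in>J. Y j \<omega> \<le> x)}"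
  define L where "L = {\<omega> \<in> space M. Y i \<omega> \<in> {..<x}}"
  define c where "c = (\<Prod>j\<in>J. measure_pmf.prob (poisson_pmf (\<theta> j)) {..x})"
  have ev: "A \<in> events" "B \<in> events" "C \<in> events" "D \<in> events" "L \<in> events"
    unfolding A_def B_def C_def D_def L_def using finJ Jd i
    by (auto intro!: sets.sets_Collect_finite_All sets.sets_Collect_conj
        common_shock_event_X common_shock_event_Y)
  have "A \<subseteq> D"
    using i J by (force simp: A_def D_def common_shock_X)
  \<comment> \<open>Without a shock, \<open>X j\<close> equals \<open>Y j\<close> for all
    \<open>j\<close>, so \<open>D\<close> already gives \<open>A\<close>. With a shock,
    \<open>Y i\<close> is strictly below \<open>X i\<close>, which is at most \<open>x\<close>; this
    strictness is why \<open>L\<close> uses \<open>{..<x}\<close>.\<close>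
  have "D \<subseteq> A \<union> L"
  proof
    fix \<omega> assume *: "\<omega> \<in> D"
    show "\<omega> \<in> A \<union> L"
    proof (cases "Y 0 \<omega> = 0")
      case True
      with * show ?thesis
        by (cases "\<omega> \<in> space M") (auto simp: A_def D_def J common_shock_X)
    next
      case False
      with * i show ?thesis
        by (auto simp: L_def D_def common_shock_X)
    qed
  qed
  have DBC: "prob D = prob B * prob C"
    unfolding B_def C_def D_def using i J by (rule common_shock_split)
  have C: "prob C = c"
    unfolding C_def c_def using common_shock_joint[OF Jd Jne, of "\<lambda>_. {..x}"] by simp
  have "c > 0"
    unfolding c_def
  proof (rule prod_pos)
    fix j assume "j \<in> J"
    with Jd pos have "0 < pmf (poisson_pmf (\<theta> j)) 0" by (auto simp: less_imp_le)
    also have "\<dots> \<le> measure_pmf.prob (poisson_pmf (\<theta> j)) {..x}"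
      by (subst measure_pmf_single[symmetric], rule measure_pmf.finite_measure_mono) auto
    finally show "0 < measure_pmf.prob (poisson_pmf (\<theta> j)) {..x}" .
  qed
  have p: "pmf (poisson_pmf (\<theta> 0)) 0 > 0" "pmf (poisson_pmf (\<theta> i)) x > 0"
    using pos[of 0] pos[of i] i by auto
  \<comment> \<open>On \<open>Y 0 = 0\<close> and \<open>Y i = x\<close> one has
    \<open>X i = x\<close>. The value \<open>x\<close> is chosen because, among the masses of
    \<open>Y i\<close> at points up to \<open>x\<close>, the one at \<open>x\<close> decays slowest
    as the rate grows, and so dominates the probability of \<open>L\<close>.\<close>
  have "pmf (poisson_pmf (\<theta> 0)) 0 * pmf (poisson_pmf (\<theta> i)) x \<le> prob B"
    unfolding common_shock_point[OF i, symmetric] using ev i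
    by (intro finite_measure_mono) (auto simp: B_def common_shock_X)
  then have le: "pmf (poisson_pmf (\<theta> 0)) 0 * pmf (poisson_pmf (\<theta> i)) x * c \<le> prob D"
    using \<open>c > 0\<close> by (simp add: DBC C)
  have posD: "prob D > 0"
    using le p \<open>c > 0\<close> by (meson less_le_trans mult_pos_pos)
  have "prob A \<le> prob D" using \<open>A \<subseteq> D\<close> ev by (intro finite_measure_mono)
  moreover have "prob D \<le> prob A + prob L"
    using finite_measure_mono[OF \<open>D \<subseteq> A \<union> L\<close>] measure_Un_le[of A M L] ev by auto
  ultimately have "\<bar>prob A / prob D - 1\<bar> \<le> prob L / prob D"
    using posD by (intro abs_div_minus_one_le) auto
  also have "\<dots> \<le> prob L / (pmf (poisson_pmf (\<theta> 0)) 0 * pmf (poisson_pmf (\<theta> i)) x * c)"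
    using le p \<open>c > 0\<close> posD by (intro divide_left_mono mult_pos_pos) auto
  also have "prob L = measure_pmf.prob (poisson_pmf (\<theta> i)) {..<x}"
    unfolding L_def using i by (intro common_shock_marginal) simp
  finally have "\<bar>prob A / (prob B * prob C) - 1\<bar>
      \<le> measure_pmf.prob (poisson_pmf (\<theta> i)) {..<x} / pmf (poisson_pmf (\<theta> i)) x /
          (pmf (poisson_pmf (\<theta> 0)) 0 * c)"
    by (simp only: DBC) (simp add: mult_ac)
  moreover have "cdf_of M (max_over {1..d} X) (real x) = prob A"
    unfolding A_def using d by (intro cdf_of_max_over common_shock_measurable_X) auto
  moreover have "cdf_of M (X i) (real x) = prob B"
    unfolding B_def using i by (intro cdf_of_nat common_shock_measurable_X)
  moreover have "cdf_of M (max_over J Y) (real x) = prob C"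
    unfolding C_def using finJ Jne Jd by (intro cdf_of_max_over common_shock_measurable_Y) auto
  ultimately show ?thesis by (simp only: c_def)
qed

text \<open>Including index \<open>i\<close> can enlarge the event only where \<open>X i\<close> is
  at most \<open>x\<close>, and there \<open>Y i\<close> is at most \<open>x\<close> too. The
  denominator is bounded below through any other index \<open>k\<close>: if \<open>Y 0\<close> and
  \<open>Y k\<close> vanish, so does \<open>X k\<close>. This lower bound does not depend on the
  rate of \<open>Y i\<close>.\<close>

lemma common_shock_min_error:
  assumes i: "i \<in> {1..d}" and k: "k \<in> {1..d}" "k \<noteq> i"
  shows "\<bar>cdf_of M (min_over {1..d} X) (real x) / cdf_of M (min_over ({1..d} - {i}) X) (real x) - 1\<bar>
         \<le> measure_pmf.prob (poisson_pmf (\<theta> i)) {..x} /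
            (pmf (poisson_pmf (\<theta> 0)) 0 * pmf (poisson_pmf (\<theta> k)) 0)"
proof -
  define A where "A = {\<omega> \<in> space M. \<exists>j\<in>{1..d}. X j \<omega> \<le> x}"
  define B where "B = {\<omega> \<in> space M. \<exists>j\<in>{1..d} - {i}. X j \<omega> \<le> x}"
  define L where "L = {\<omega> \<in> space M. Y i \<omega> \<in> {..x}}"
  define c where "c = pmf (poisson_pmf (\<theta> 0)) 0 * pmf (poisson_pmf (\<theta> k)) 0"
  have ev: "A \<in> events" "B \<in> events" "L \<in> events"
    unfolding A_def B_def L_def using i
    by (auto intro!: sets.sets_Collect_finite_Ex common_shock_event_X common_shock_event_Y)
  have "c > 0"
    using csp k i by (auto simp: c_def common_shock_poisson_def less_imp_le)
  have "c \<le> prob B"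
    unfolding c_def common_shock_point[OF k(1), symmetric] using ev k
    by (intro finite_measure_mono) (auto simp: B_def common_shock_X intro!: bexI[of _ k])
  have "prob B \<le> prob A" using ev by (intro finite_measure_mono) (auto simp: A_def B_def)
  moreover have "A \<subseteq> B \<union> L"
    using i by (fastforce simp: A_def B_def L_def common_shock_X)
  then have "prob A \<le> prob B + prob L"
    using finite_measure_mono[OF \<open>A \<subseteq> B \<union> L\<close>] measure_Un_le[of B M L] ev by auto
  ultimately have "\<bar>prob A / prob B - 1\<bar> \<le> prob L / prob B"
    using \<open>c > 0\<close> \<open>c \<le> prob B\<close> by (intro abs_div_minus_one_le) auto
  also have "\<dots> \<le> prob L / c"
    using \<open>c > 0\<close> \<open>c \<le> prob B\<close> by (intro divide_left_mono mult_pos_pos) auto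
  also have "prob L = measure_pmf.prob (poisson_pmf (\<theta> i)) {..x}"
    unfolding L_def using i by (intro common_shock_marginal) simp
  finally have "\<bar>prob A / prob B - 1\<bar> \<le> measure_pmf.prob (poisson_pmf (\<theta> i)) {..x} / c" .
  moreover have "cdf_of M (min_over {1..d} X) (real x) = prob A"
    unfolding A_def using k by (intro cdf_of_min_over common_shock_measurable_X) auto
  moreover have "cdf_of M (min_over ({1..d} - {i}) X) (real x) = prob B"
    unfolding B_def using k by (intro cdf_of_min_over common_shock_measurable_X) auto
  ultimately show ?thesis by (simp only: c_def)
qed

end

section \<open>Poisson lower tails as the rate tends to infinity\<close>

text \<open>The probability is a finite sum of terms \<open>t ^ k / exp t / fact k\<close>, and the
  exponential outgrows every power.\<close>

lemma poisson_prob_atMost_tendsto_0: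
  "((\<lambda>t. measure_pmf.prob (poisson_pmf t) {..x}) \<longlongrightarrow> 0) at_top"
proof -
  have "((\<lambda>t::real. \<Sum>k\<le>x. t ^ k / exp t / fact k) \<longlongrightarrow> (\<Sum>k\<le>x. 0 / fact k)) at_top"
    by (intro tendsto_sum tendsto_divide tendsto_power_div_exp_0 tendsto_const) simp
  \<comment> \<open>The explicit mass formula requires a nonnegative rate, so the two functions are
    identified only for positive \<open>t\<close>.\<close>
  moreover have "eventually (\<lambda>t::real. (\<Sum>k\<le>x. t ^ k / exp t / fact k)
      = measure_pmf.prob (poisson_pmf t) {..x}) at_top"
    using eventually_gt_at_top[of 0]
    by eventually_elim
      (auto simp: measure_measure_pmf_finite exp_minus field_simps intro!: sum.cong)
  ultimately show ?thesis by (simp add: tendsto_cong)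
qed

text \<open>In the quotient of the masses at \<open>k\<close> and \<open>x\<close> the exponentials
  cancel, leaving \<open>fact x / fact k\<close> times a negative power of \<open>t\<close>, because
  \<open>k < x\<close>. For \<open>x = 0\<close> the sum is empty.\<close>

lemma poisson_prob_lessThan_div_pmf_tendsto_0:
  "((\<lambda>t. measure_pmf.prob (poisson_pmf t) {..<x} / pmf (poisson_pmf t) x) \<longlongrightarrow> 0) at_top"
proof -
  have "((\<lambda>t::real. \<Sum>k<x. inverse (t ^ (x - k)) * (fact x / fact k))
      \<longlongrightarrow> (\<Sum>k<x. 0 * (fact x / fact k))) at_top"
    by (intro tendsto_sum tendsto_mult tendsto_const tendsto_inverse_0_at_top filterlim_pow_at_top
        filterlim_ident) auto
  moreover have "eventually (\<lambda>t::real. (\<Sum>k<x. inverse (t ^ (x - k)) * (fact x / fact k))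
      = measure_pmf.prob (poisson_pmf t) {..<x} / pmf (poisson_pmf t) x) at_top"
    using eventually_gt_at_top[of 0]
  proof eventually_elim
    case (elim t)
    have "inverse (t ^ (x - k)) * (fact x / fact k) = pmf (poisson_pmf t) k / pmf (poisson_pmf t) x"
      if "k < x" for k
      using elim that by (simp add: power_diff field_simps)
    then show ?case
      by (simp add: measure_measure_pmf_finite sum_divide_distrib)
  qed
  ultimately show ?thesis by (simp add: tendsto_cong)
qed

section \<open>Passage to the limit in the error bounds\<close>

theorem proposition4p1:
  fixes d i x :: nat
    and \<theta> :: "nat \<Rightarrow> real"
    and M :: "real \<Rightarrow> 'a measure"
    and X Y :: "real \<Rightarrow> nat \<Rightarrow> 'a \<Rightarrow> nat"
  assumes "d \<ge> 2"
    and "i \<in> {1..d}"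
    and "\<forall>j\<in>{0..d} - {i}. 0 < \<theta> j"
    and "\<And>t. t > 0 \<Longrightarrow> common_shock_poisson (M t) d (\<theta>(i := t)) (X t) (Y t)"
  shows "((\<lambda>t. cdf_of (M t) (max_over {1..d} (X t)) (real x) /
               (cdf_of (M t) (X t i) (real x) *
                cdf_of (M t) (max_over ({1..d} - {i}) (Y t)) (real x))) \<longlongrightarrow> 1) at_top \<and>
         ((\<lambda>t. cdf_of (M t) (min_over {1..d} (X t)) (real x) /
               cdf_of (M t) (min_over ({1..d} - {i}) (X t)) (real x)) \<longlongrightarrow> 1) at_top"
proof -
  let ?J = "{1..d} - {i}"
  have csp: "common_shock_poisson (M t) d (\<theta>(i := t)) (X t) (Y t)" if "t > 0" for t
    using assms(4) that by blast
  obtain k where k: "k \<in> {1..d}" "k \<noteq> i"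
    using assms(1,2) by (intro that[of "if i = 1 then 2 else 1"]) auto
  \<comment> \<open>Both 0 and \<open>k\<close> differ from \<open>i\<close>, so the lower bounds on
    the denominators are free of \<open>t\<close>; \<open>prod_upd\<close> gives the same for the
    product over the indices other than \<open>i\<close>.\<close>
  have upd: "(\<theta>(i := t)) 0 = \<theta> 0" "(\<theta>(i := t)) k = \<theta> k" for t
    using assms(2) k by auto
  have prod_upd: "(\<Prod>j\<in>?J. measure_pmf.prob (poisson_pmf ((\<theta>(i := t)) j)) {..x})
      = (\<Prod>j\<in>?J. measure_pmf.prob (poisson_pmf (\<theta> j)) {..x})" for t
    by (intro prod.cong) auto
  \<comment> \<open>The spaces \<open>M t\<close> for different \<open>t\<close> need not be
    related: the fixed-rate bound is applied at each positive \<open>t\<close> separately, and it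
    depends on \<open>t\<close> only through a vanishing Poisson quotient divided by a
    constant.\<close>
  have "((\<lambda>t. cdf_of (M t) (max_over {1..d} (X t)) (real x) /
               (cdf_of (M t) (X t i) (real x) * cdf_of (M t) (max_over ?J (Y t)) (real x)) - 1)
         \<longlongrightarrow> 0) at_top"
  proof (rule Lim_null_comparison)
    show "\<forall>\<^sub>F t in at_top. norm (cdf_of (M t) (max_over {1..d} (X t)) (real x) /
               (cdf_of (M t) (X t i) (real x) * cdf_of (M t) (max_over ?J (Y t)) (real x)) - 1)
            \<le> measure_pmf.prob (poisson_pmf t) {..<x} / pmf (poisson_pmf t) x /
               (pmf (poisson_pmf (\<theta> 0)) 0 * (\<Prod>j\<in>?J. measure_pmf.prob (poisson_pmf (\<theta> j)) {..x}))"
      using eventually_gt_at_top[of 0]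
    proof eventually_elim
      case (elim t)
      show ?case
        using common_shock_max_error[OF csp[OF elim] assms(1,2) refl, of x]
        by (simp only: upd prod_upd fun_upd_same real_norm_def)
    qed
  qed (intro tendsto_divide_zero poisson_prob_lessThan_div_pmf_tendsto_0)
  moreover have "((\<lambda>t. cdf_of (M t) (min_over {1..d} (X t)) (real x) /
               cdf_of (M t) (min_over ?J (X t)) (real x) - 1) \<longlongrightarrow> 0) at_top"
  proof (rule Lim_null_comparison)
    show "\<forall>\<^sub>F t in at_top. norm (cdf_of (M t) (min_over {1..d} (X t)) (real x) /
               cdf_of (M t) (min_over ?J (X t)) (real x) - 1)
            \<le> measure_pmf.prob (poisson_pmf t) {..x} /
               (pmf (poisson_pmf (\<theta> 0)) 0 * pmf (poisson_pmf (\<theta> k)) 0)"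
      using eventually_gt_at_top[of 0]
    proof eventually_elim
      case (elim t)
      show ?case
        using common_shock_min_error[OF csp[OF elim] assms(2) k, of x]
        by (simp only: upd fun_upd_same real_norm_def)
    qed
  qed (intro tendsto_divide_zero poisson_prob_atMost_tendsto_0)
  ultimately show ?thesis
    by (simp only: LIM_zero_iff)
qed

end
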